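(* Let $L$ be a frame and let $X$ be its Priestley space of prime filters. Then $L$ is Hausdorff if and only if $\mathrm{cl}(\mathrm{haus}\, U) = U$ for each clopen upset $U \in \mathrm{ClopUp}(X)$.
   Context: A frame is a complete lattice satisfying $a \wedge \bigvee S = \bigvee\{a \wedge s \mid s \in S\}$. The Priestley space of a frame $L$ is the set $X$ of (proper) prime filters of $L$ ordered by inclusion, with topology generated by the basis $\{\sigma(a) \cap \sigma(b)^c \mid a,b \in L\}$, where $\sigma(a) = \{x \in X \mid a \in x\}$. The axiom of choice is assumed. $\mathrm{ClopUp}(X)$ is the set of clopen upsets of $X$; $\mathrm{cl}$ is topological closure in $X$; $U^c = X \setminus U$; $\max S$ is the set of maximal elements of $S \subseteq X$; $\uparrow x = \{y \in X \mid x \le y\}$. For $c\in L$, $c^*$ denotes the pseudocomplement of $c$ (the largest element whose meet with $c$ is $0$). A frame $L$ is Hausdorff (in the sense of Johnstone and Sun) if for all $a,b \in L$ with $a \neq 1$ and $a \nleq b$ there is $c \in L$ with $c \nleq a$ and $c^* \nleq b$. For $U \in \mathrm{ClopUp}(X)$, the Hausdorff kernel of $U$ is $$\mathrm{haus}\, U = \{x \in U \mid U \neq X \Rightarrow \exists y \in \max(U^c) : \uparrow y \cap \uparrow x = \varnothing\}.$$ *)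

theory Defs
  imports "HOL-Analysis.Abstract_Topology"
begin

(* The library class complete_distrib_lattice demands complete distributivity, which is
   strictly stronger than the frame law. *)
class frame = complete_lattice +
  assumes inf_Sup_frame: "inf a (Sup S) = (SUP s\<in>S. inf a s)"

definition pseudocomplement :: "'a::frame \<Rightarrow> 'a" where
  "pseudocomplement c = (GREATEST x. inf c x = bot)"

lemma inf_eq_bot_iff_le_pseudocomplement:
  fixes c x :: "'a::frame"
  shows "inf c x = bot \<longleftrightarrow> x \<le> pseudocomplement c"
proof -
  let ?s = "Sup {x. inf c x = bot}"
  have s: "inf c ?s = bot"
    unfolding inf_Sup_frame by (rule antisym) (auto intro: SUP_least)
  have eq: "pseudocomplement c = ?s"
    unfolding pseudocomplement_def
    by (rule Greatest_equality) (use s in \<open>auto intro: Sup_upper\<close>)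
  show ?thesis
  proof
    assume "inf c x = bot"
    then show "x \<le> pseudocomplement c" unfolding eq by (auto intro: Sup_upper)
  next
    assume "x \<le> pseudocomplement c"
    then have "inf c x \<le> inf c ?s" unfolding eq by (rule inf_mono[OF order_refl])
    then show "inf c x = bot" using s by (simp add: bot_unique)
  qed
qed

(* A frame is a type of class frame, so this is a property of the type 'a. *)
definition hausdorff_frame :: "'a::frame itself \<Rightarrow> bool" where
  "hausdorff_frame _ \<longleftrightarrow>
     (\<forall>a b :: 'a. a \<noteq> top \<and> \<not> a \<le> b \<longrightarrow>
        (\<exists>c. \<not> c \<le> a \<and> \<not> pseudocomplement c \<le> b))"

(* Prime filters are proper: bot is excluded. *)
definition prime_filter :: "'a::bounded_lattice set \<Rightarrow> bool" where
  "prime_filter F \<longleftrightarrow>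
     top \<in> F \<and> bot \<notin> F \<and>
     (\<forall>a b. a \<in> F \<and> a \<le> b \<longrightarrow> b \<in> F) \<and>
     (\<forall>a b. a \<in> F \<and> b \<in> F \<longrightarrow> inf a b \<in> F) \<and>
     (\<forall>a b. sup a b \<in> F \<longrightarrow> a \<in> F \<or> b \<in> F)"

(* The order on the Priestley space is inclusion, written with the library's subset relation. *)
definition priestley_space :: "'a::frame set set" where
  "priestley_space = {x. prime_filter x}"

definition stone_map :: "'a::frame \<Rightarrow> 'a set set" where
  "stone_map a = {x \<in> priestley_space. a \<in> x}"

definition priestley_topology :: "'a::frame set topology" where
  "priestley_topology =
     topology_generated_by {stone_map a \<inter> (priestley_space - stone_map b) | a b. True}"

lemma topspace_priestley_topology:
  "topspace (priestley_topology :: 'a::frame set topology) = priestley_space"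
proof -
  have "stone_map top \<inter> (priestley_space - stone_map bot) = (priestley_space :: 'a set set)"
    by (auto simp: stone_map_def priestley_space_def prime_filter_def)
  then have "priestley_space \<subseteq>
      \<Union>{stone_map a \<inter> (priestley_space - stone_map b) | a b :: 'a. True}"
    by blast
  then show ?thesis
    unfolding priestley_topology_def topology_generated_by_topspace by blast
qed

definition ClopUp :: "'a::frame set set set" where
  "ClopUp = {U. openin priestley_topology U \<and> closedin priestley_topology U \<and>
                (\<forall>x\<in>U. \<forall>y\<in>priestley_space. x \<subseteq> y \<longrightarrow> y \<in> U)}"

definition max_points :: "'a::frame set set \<Rightarrow> 'a set set" where
  "max_points S = {x \<in> S. \<forall>y\<in>S. x \<subseteq> y \<longrightarrow> y = x}"

definition up_set :: "'a::frame set \<Rightarrow> 'a set set" where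
  "up_set x = {y \<in> priestley_space. x \<subseteq> y}"

definition haus :: "'a::frame set set \<Rightarrow> 'a set set" where
  "haus U = {x \<in> U. U \<noteq> priestley_space \<longrightarrow>
               (\<exists>y \<in> max_points (priestley_space - U). up_set y \<inter> up_set x = {})}"

end

theory Submission
  imports Defs "HOL-Analysis.Function_Topology"
begin

text \<open>
  The link between the algebra and the topology is that two points \<open>x\<close>, \<open>y\<close> of the Priestley space
  have disjoint up-sets exactly when some \<open>c \<in> y\<close> has its pseudocomplement in \<open>x\<close>: a common upper
  bound is a prime filter containing \<open>x \<union> y\<close>, and by the prime filter theorem one exists
  unless the filter generated by \<open>x \<union> y\<close> contains \<open>bot\<close>
  (\<open>disjoint_up_sets_iff_pseudocomplement\<close>). Hence, for \<open>a \<noteq> top\<close>, a point \<open>x\<close> of \<open>stone_map a\<close> lies in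
  the Hausdorff kernel exactly when some \<open>c\<close> with \<open>\<not> c \<le> a\<close> has \<open>pseudocomplement c \<in> x\<close>
  (\<open>in_haus_stone_map_iff\<close>); here \<open>\<not> c \<le> a\<close> provides a prime filter containing \<open>c\<close> and omitting
  \<open>a\<close>, even one that is maximal among those omitting \<open>a\<close>.

  So the kernel of \<open>stone_map a\<close> is its intersection with the union of the sets
  \<open>stone_map (pseudocomplement c)\<close> over all \<open>c\<close> with \<open>\<not> c \<le> a\<close>. Density of the kernel means that it
  meets each nonempty basic set inside \<open>stone_map a\<close>. The set \<open>stone_map a - stone_map b\<close> is
  nonempty iff \<open>\<not> a \<le> b\<close>, and if the kernel meets it, then \<open>\<not> pseudocomplement c \<le> b\<close> for one of
  these \<open>c\<close>, which is the Hausdorff condition. Conversely, in order to meet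
  \<open>stone_map (inf a d) - stone_map e\<close>, the Hausdorff condition is applied to \<open>a\<close> and the Heyting
  implication \<open>inf a d \<rightarrow> e\<close>.

  That the clopen upsets are exactly the sets \<open>stone_map a\<close> is the usual compactness argument of
  Priestley duality (\<open>ClopUp_eq_range_stone_map\<close>); compactness itself comes from the prime filter
  theorem through Alexander's subbase theorem.
\<close>

section \<open>Filters, ideals and the prime filter theorem\<close>

definition lattice_filter :: "'a::bounded_lattice set \<Rightarrow> bool" where
  "lattice_filter F \<longleftrightarrow>
     top \<in> F \<and> (\<forall>a b. a \<in> F \<and> a \<le> b \<longrightarrow> b \<in> F) \<and> (\<forall>a b. a \<in> F \<and> b \<in> F \<longrightarrow> inf a b \<in> F)"

definition lattice_ideal :: "'a::bounded_lattice set \<Rightarrow> bool" where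
  "lattice_ideal I \<longleftrightarrow>
     bot \<in> I \<and> (\<forall>a b. b \<in> I \<and> a \<le> b \<longrightarrow> a \<in> I) \<and> (\<forall>a b. a \<in> I \<and> b \<in> I \<longrightarrow> sup a b \<in> I)"

definition filter_join :: "'a::bounded_lattice set \<Rightarrow> 'a set \<Rightarrow> 'a set" where
  "filter_join F G = {z. \<exists>f\<in>F. \<exists>g\<in>G. inf f g \<le> z}"

lemma lattice_filter_atLeast: "lattice_filter {a..}"
  by (auto simp: lattice_filter_def intro: order_trans)

lemma lattice_ideal_atMost: "lattice_ideal {..a}"
  by (auto simp: lattice_ideal_def intro: order_trans)

lemma prime_filter_imp_lattice_filter: "prime_filter P \<Longrightarrow> lattice_filter P"
  by (simp add: prime_filter_def lattice_filter_def)

lemma lattice_filter_filter_join: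
  assumes F: "lattice_filter F" and G: "lattice_filter G"
  shows "lattice_filter (filter_join F G)"
  unfolding lattice_filter_def
proof (intro conjI allI impI)
  show "top \<in> filter_join F G"
    using F G by (auto simp: lattice_filter_def filter_join_def)
next
  fix a b assume "a \<in> filter_join F G \<and> a \<le> b"
  then show "b \<in> filter_join F G"
    by (auto simp: filter_join_def intro: order_trans)
next
  fix a b assume "a \<in> filter_join F G \<and> b \<in> filter_join F G"
  then obtain f g f' g' where fg: "f \<in> F" "f' \<in> F" "g \<in> G" "g' \<in> G"
    and le: "inf f g \<le> a" "inf f' g' \<le> b"
    by (auto simp: filter_join_def)
  have "inf (inf f f') (inf g g') = inf (inf f g) (inf f' g')"
    by (simp add: ac_simps)
  also have "\<dots> \<le> inf a b"
    using le by (rule inf_mono)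
  finally show "inf a b \<in> filter_join F G"
    using F G fg unfolding filter_join_def lattice_filter_def by blast
qed

lemma subset_filter_join:
  assumes "lattice_filter F" "lattice_filter G"
  shows "F \<subseteq> filter_join F G" "G \<subseteq> filter_join F G"
  using assms by (fastforce simp: lattice_filter_def filter_join_def intro: inf_le1 inf_le2)+

text \<open>
  If \<open>P\<close> is maximal and contained neither \<open>u\<close> nor \<open>v\<close>, then adjoining either of them would produce a
  filter that meets \<open>I\<close>, say in elements above \<open>inf p u\<close> and \<open>inf q v\<close>. By distributivity
  \<open>inf (inf p q) (sup u v)\<close> lies in \<open>I\<close>, so \<open>sup u v\<close> is not in \<open>P\<close>.
\<close>
lemma maximal_filter_prime:
  fixes P I :: "'a::{bounded_lattice,distrib_lattice} set"
  assumes P: "lattice_filter P" and I: "lattice_ideal I" and disj: "P \<inter> I = {}"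
    and max: "\<forall>Q. lattice_filter Q \<longrightarrow> P \<subseteq> Q \<longrightarrow> Q \<inter> I = {} \<longrightarrow> Q = P"
  shows "prime_filter P"
proof -
  have meet: "\<exists>p\<in>P. inf p u \<in> I" if "u \<notin> P" for u
  proof -
    let ?Q = "filter_join P {u..}"
    have "P \<subseteq> ?Q" "u \<in> ?Q"
      using subset_filter_join[OF P lattice_filter_atLeast[of u]] by auto
    with that have "?Q \<inter> I \<noteq> {}"
      using max lattice_filter_filter_join[OF P lattice_filter_atLeast] by blast
    then obtain p g z where "p \<in> P" "u \<le> g" "inf p g \<le> z" "z \<in> I"
      by (auto simp: filter_join_def)
    moreover from this have "inf p u \<le> z"
      by (meson inf_mono order_refl order_trans)
    ultimately show ?thesis
      using I unfolding lattice_ideal_def by blast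
  qed
  have "u \<in> P \<or> v \<in> P" if uv: "sup u v \<in> P" for u v
  proof (rule ccontr)
    assume "\<not> (u \<in> P \<or> v \<in> P)"
    then obtain p q where p: "p \<in> P" "inf p u \<in> I" and q: "q \<in> P" "inf q v \<in> I"
      using meet by blast
    have "inf (inf p q) (sup u v) = sup (inf (inf p q) u) (inf (inf p q) v)"
      by (rule inf_sup_distrib1)
    also have "\<dots> \<le> sup (inf p u) (inf q v)"
      by (intro sup_mono inf_mono inf_le1 inf_le2 order_refl)
    finally have "inf (inf p q) (sup u v) \<in> I"
      using I p q unfolding lattice_ideal_def by blast
    moreover have "inf (inf p q) (sup u v) \<in> P"
      using P p q uv unfolding lattice_filter_def by blast
    ultimately show False
      using disj by blast
  qed
  then show ?thesis
    using P I disj unfolding prime_filter_def lattice_filter_def lattice_ideal_def by blast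
qed

text \<open>
  Maximality is part of the conclusion because it is what turns a prime filter omitting \<open>a\<close> into a
  maximal point of the complement of \<open>stone_map a\<close>.
\<close>
theorem prime_filter_extension:
  fixes F I :: "'a::{bounded_lattice,distrib_lattice} set"
  assumes F: "lattice_filter F" and I: "lattice_ideal I" and disj: "F \<inter> I = {}"
  obtains P where "prime_filter P" "F \<subseteq> P" "P \<inter> I = {}"
    "\<forall>Q. lattice_filter Q \<longrightarrow> P \<subseteq> Q \<longrightarrow> Q \<inter> I = {} \<longrightarrow> Q = P"
proof -
  define \<A> where "\<A> = {G. lattice_filter G \<and> F \<subseteq> G \<and> G \<inter> I = {}}"
  have "\<exists>M\<in>\<A>. \<forall>X\<in>\<A>. M \<subseteq> X \<longrightarrow> X = M"
  proof (rule subset_Zorn_nonempty)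
    show "\<A> \<noteq> {}"
      using F disj by (auto simp: \<A>_def)
  next
    fix \<C> assume ne: "\<C> \<noteq> {}" and ch: "subset.chain \<A> \<C>"
    have mem: "lattice_filter G" "F \<subseteq> G" "G \<inter> I = {}" if "G \<in> \<C>" for G
      using ch that by (auto simp: subset_chain_def \<A>_def)
    have "inf a b \<in> \<Union>\<C>" if "a \<in> \<Union>\<C>" "b \<in> \<Union>\<C>" for a b
    proof -
      obtain G where "G \<in> \<C>" "a \<in> G" "b \<in> G"
        using ch \<open>a \<in> \<Union>\<C>\<close> \<open>b \<in> \<Union>\<C>\<close> unfolding subset_chain_def by blast
      then show ?thesis
        using mem(1) unfolding lattice_filter_def by blast
    qed
    moreover have "top \<in> \<Union>\<C>"
      using ne mem(1) unfolding lattice_filter_def by blast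
    moreover have "b \<in> \<Union>\<C>" if "a \<in> \<Union>\<C>" "a \<le> b" for a b
      using that mem(1) unfolding lattice_filter_def by blast
    ultimately have "lattice_filter (\<Union>\<C>)"
      unfolding lattice_filter_def by blast
    then show "\<Union>\<C> \<in> \<A>"
      using ne mem(2,3) unfolding \<A>_def by blast
  qed
  then obtain P where "P \<in> \<A>" and max: "\<forall>Q\<in>\<A>. P \<subseteq> Q \<longrightarrow> Q = P"
    by (elim bexE)
  then have P: "lattice_filter P" "F \<subseteq> P" "P \<inter> I = {}"
    by (auto simp: \<A>_def)
  have "Q = P" if "lattice_filter Q" "P \<subseteq> Q" "Q \<inter> I = {}" for Q
    using that P(2) max by (auto simp: \<A>_def)
  then have max: "\<forall>Q. lattice_filter Q \<longrightarrow> P \<subseteq> Q \<longrightarrow> Q \<inter> I = {} \<longrightarrow> Q = P"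
    by (intro allI impI)
  show thesis
    by (rule that[OF maximal_filter_prime[OF P(1) I P(3) max] P(2,3) max])
qed

section \<open>Points of the Priestley space of a frame\<close>

subclass (in frame) distrib_lattice
proof
  fix x y z :: 'a
  have distrib: "inf a (sup b c) = sup (inf a b) (inf a c)" for a b c
    using inf_Sup_frame[of a "{b, c}"] by simp
  show "sup x (inf y z) = inf (sup x y) (sup x z)"
    by (rule distrib_imp1) (rule distrib)
qed

lemma priestley_space_up:
  "x \<in> priestley_space \<Longrightarrow> a \<in> x \<Longrightarrow> a \<le> b \<Longrightarrow> b \<in> x"
  unfolding priestley_space_def prime_filter_def by blast

lemma priestley_space_inf_iff:
  "x \<in> priestley_space \<Longrightarrow> inf a b \<in> x \<longleftrightarrow> a \<in> x \<and> b \<in> x"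
  by (metis inf_le1 inf_le2 mem_Collect_eq prime_filter_def priestley_space_def)

lemma priestley_space_sup_iff:
  "x \<in> priestley_space \<Longrightarrow> sup a b \<in> x \<longleftrightarrow> a \<in> x \<or> b \<in> x"
  by (metis mem_Collect_eq prime_filter_def priestley_space_def sup_ge1 sup_ge2)

lemma priestley_space_top_bot:
  "x \<in> priestley_space \<Longrightarrow> top \<in> x" "x \<in> priestley_space \<Longrightarrow> bot \<notin> x"
  unfolding priestley_space_def prime_filter_def by blast+

lemma priestley_space_Inf_iff:
  assumes "x \<in> priestley_space" "finite T"
  shows "Inf T \<in> x \<longleftrightarrow> T \<subseteq> x"
  using assms(2)
  by (induction T) (simp_all add: assms(1) priestley_space_inf_iff priestley_space_top_bot)

lemma priestley_space_Sup_iff: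
  assumes "x \<in> priestley_space" "finite S"
  shows "Sup S \<in> x \<longleftrightarrow> S \<inter> x \<noteq> {}"
  using assms(2)
  by (induction S) (auto simp add: assms(1) priestley_space_sup_iff priestley_space_top_bot)

lemma maximal_point_separating:
  fixes a b :: "'a::frame"
  assumes "\<not> a \<le> b"
  obtains x where "x \<in> max_points (priestley_space - stone_map b)" "a \<in> x"
proof -
  have "{a..} \<inter> {..b} = {}"
    using assms by (auto intro: order_trans)
  then obtain P where P: "prime_filter P" "{a..} \<subseteq> P" "P \<inter> {..b} = {}"
    and max: "\<forall>Q. lattice_filter Q \<longrightarrow> P \<subseteq> Q \<longrightarrow> Q \<inter> {..b} = {} \<longrightarrow> Q = P"
    by (rule prime_filter_extension[OF lattice_filter_atLeast lattice_ideal_atMost])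
  have "Q = P" if "Q \<in> priestley_space - stone_map b" "P \<subseteq> Q" for Q
  proof (rule max[rule_format])
    show "lattice_filter Q"
      using that prime_filter_imp_lattice_filter by (auto simp: priestley_space_def)
    show "Q \<inter> {..b} = {}"
      using that priestley_space_up[of Q] by (auto simp: stone_map_def)
  qed (fact that)
  with P show thesis
    by (intro that[of P]) (auto simp: max_points_def stone_map_def priestley_space_def)
qed

lemma max_points_subset: "max_points S \<subseteq> S"
  by (auto simp: max_points_def)

lemma stone_map_subset_iff: "stone_map a \<subseteq> stone_map b \<longleftrightarrow> a \<le> b"
proof
  assume sub: "stone_map a \<subseteq> stone_map b"
  show "a \<le> b"
  proof (rule ccontr)
    assume "\<not> a \<le> b"
    then obtain x where "x \<in> max_points (priestley_space - stone_map b)" "a \<in> x"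
      by (rule maximal_point_separating)
    with sub max_points_subset show False
      by (fastforce simp: stone_map_def)
  qed
qed (auto simp: stone_map_def dest: priestley_space_up)

lemma stone_map_top: "stone_map top = priestley_space"
  by (auto simp: stone_map_def priestley_space_top_bot)

lemma stone_map_eq_space_iff: "stone_map a = priestley_space \<longleftrightarrow> a = top"
  by (metis stone_map_subset_iff stone_map_top order_refl top_unique)

text \<open>
  The filter generated by \<open>B\<close> consists of the elements above finite meets of \<open>B\<close>, and dually for
  the ideal generated by \<open>A\<close>. A prime filter separating them exists unless they intersect.
\<close>
lemma finite_meet_le_finite_join:
  fixes A B :: "'a::frame set"
  assumes nosep: "\<And>x. x \<in> priestley_space \<Longrightarrow> B \<subseteq> x \<Longrightarrow> A \<inter> x \<noteq> {}"
  obtains T S where "finite T" "T \<subseteq> B" "finite S" "S \<subseteq> A" "Inf T \<le> Sup S"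
proof -
  define F where "F = {z. \<exists>T. finite T \<and> T \<subseteq> B \<and> Inf T \<le> z}"
  define I where "I = {z. \<exists>S. finite S \<and> S \<subseteq> A \<and> z \<le> Sup S}"
  have "inf a b \<in> F" if "a \<in> F" "b \<in> F" for a b
  proof -
    obtain T T' where "finite T" "T \<subseteq> B" "Inf T \<le> a" "finite T'" "T' \<subseteq> B" "Inf T' \<le> b"
      using \<open>a \<in> F\<close> \<open>b \<in> F\<close> unfolding F_def by blast
    then show ?thesis
      unfolding F_def by (auto intro!: exI[of _ "T \<union> T'"] simp: Inf_union_distrib le_infI1 le_infI2)
  qed
  moreover have "top \<in> F"
    unfolding F_def by auto
  moreover have "b \<in> F" if "a \<in> F" "a \<le> b" for a b
    using that unfolding F_def by (blast intro: order_trans)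
  ultimately have F: "lattice_filter F"
    unfolding lattice_filter_def by blast
  have "sup a b \<in> I" if "a \<in> I" "b \<in> I" for a b
  proof -
    obtain S S' where "finite S" "S \<subseteq> A" "a \<le> Sup S" "finite S'" "S' \<subseteq> A" "b \<le> Sup S'"
      using \<open>a \<in> I\<close> \<open>b \<in> I\<close> unfolding I_def by blast
    then show ?thesis
      unfolding I_def by (auto intro!: exI[of _ "S \<union> S'"] simp: Sup_union_distrib le_supI1 le_supI2)
  qed
  moreover have "bot \<in> I"
    unfolding I_def by auto
  moreover have "a \<in> I" if "b \<in> I" "a \<le> b" for a b
    using that unfolding I_def by (blast intro: order_trans)
  ultimately have I: "lattice_ideal I"
    unfolding lattice_ideal_def by blast
  have "F \<inter> I \<noteq> {}"
  proof
    assume "F \<inter> I = {}"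
    with F I obtain P where P: "prime_filter P" "F \<subseteq> P" "P \<inter> I = {}"
      by (rule prime_filter_extension)
    have "b \<in> F" if "b \<in> B" for b
      using that unfolding F_def by (auto intro!: exI[of _ "{b}"])
    moreover have "a \<in> I" if "a \<in> A" for a
      using that unfolding I_def by (auto intro!: exI[of _ "{a}"])
    ultimately show False
      using nosep[of P] P by (auto simp: priestley_space_def)
  qed
  then show thesis
    unfolding F_def I_def using that by (blast intro: order_trans)
qed

text \<open>
  When no prime filter contains both \<open>x\<close> and \<open>y\<close>, the join of these two filters contains \<open>bot\<close>,
  so some \<open>c \<in> y\<close> and \<open>d \<in> x\<close> have meet \<open>bot\<close>, whence \<open>d \<le> pseudocomplement c\<close>.
\<close>
lemma disjoint_up_sets_iff_pseudocomplement:
  fixes x y :: "'a::frame set"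
  assumes x: "x \<in> priestley_space" and y: "y \<in> priestley_space"
  shows "up_set y \<inter> up_set x = {} \<longleftrightarrow> (\<exists>c\<in>y. pseudocomplement c \<in> x)"
proof
  assume disj: "up_set y \<inter> up_set x = {}"
  let ?J = "filter_join y x"
  have xy: "lattice_filter y" "lattice_filter x"
    using x y by (simp_all add: priestley_space_def prime_filter_imp_lattice_filter)
  have "?J \<inter> {..bot} \<noteq> {}"
  proof
    assume "?J \<inter> {..bot} = {}"
    then obtain P where "prime_filter P" "?J \<subseteq> P"
      by (rule prime_filter_extension[OF lattice_filter_filter_join[OF xy] lattice_ideal_atMost])
    then have "P \<in> up_set y \<inter> up_set x"
      using subset_filter_join[OF xy] by (auto simp: up_set_def priestley_space_def)
    with disj show False
      by blast
  qed
  then obtain c d where "c \<in> y" "d \<in> x" "inf c d = bot"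
    by (auto simp: filter_join_def bot_unique)
  then show "\<exists>c\<in>y. pseudocomplement c \<in> x"
    using x inf_eq_bot_iff_le_pseudocomplement priestley_space_up by blast
next
  assume "\<exists>c\<in>y. pseudocomplement c \<in> x"
  then obtain c where c: "c \<in> y" "pseudocomplement c \<in> x"
    by blast
  have "inf c (pseudocomplement c) = bot"
    by (simp add: inf_eq_bot_iff_le_pseudocomplement)
  then have False if "z \<in> priestley_space" "y \<subseteq> z" "x \<subseteq> z" for z
    using c that priestley_space_inf_iff[OF that(1), of c "pseudocomplement c"]
      priestley_space_top_bot(2)[OF that(1)] by auto
  then show "up_set y \<inter> up_set x = {}"
    by (auto simp: up_set_def)
qed

section \<open>Topology of the Priestley space\<close>

lemma stone_map_subset_space: "stone_map a \<subseteq> priestley_space"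
  by (auto simp: stone_map_def)

lemma openin_stone_map_Diff: "openin priestley_topology (stone_map a - stone_map b)"
proof -
  have "stone_map a - stone_map b = stone_map a \<inter> (priestley_space - stone_map b)"
    using stone_map_subset_space by blast
  then show ?thesis
    unfolding priestley_topology_def by (auto intro!: topology_generated_by_Basis)
qed

lemma stone_map_bot: "stone_map bot = {}"
  by (auto simp: stone_map_def priestley_space_top_bot)

lemma openin_stone_map: "openin priestley_topology (stone_map a)"
  using openin_stone_map_Diff[of a bot] by (simp add: stone_map_bot)

lemma openin_Diff_stone_map: "openin priestley_topology (priestley_space - stone_map a)"
  using openin_stone_map_Diff[of top a] by (simp add: stone_map_top)

lemma closedin_stone_map: "closedin priestley_topology (stone_map a)"
  by (simp add: closedin_def topspace_priestley_topology stone_map_subset_space openin_Diff_stone_map)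

lemma stone_map_ClopUp: "stone_map a \<in> ClopUp"
  by (auto simp: ClopUp_def openin_stone_map closedin_stone_map) (auto simp: stone_map_def)

text \<open>
  The basic sets are closed under intersection, by
  \<open>(stone_map a - stone_map b) \<inter> (stone_map c - stone_map d)
   = stone_map (inf a c) - stone_map (sup b d)\<close>.
\<close>
lemma priestley_basis:
  assumes "openin priestley_topology T" "x \<in> T"
  obtains a b where "x \<in> stone_map a - stone_map b" "stone_map a - stone_map b \<subseteq> T"
proof -
  have "generate_topology_on {stone_map a \<inter> (priestley_space - stone_map b) |a b. True} T"
    using assms(1) by (simp add: priestley_topology_def openin_topology_generated_by_iff)
  then have "\<forall>x\<in>T. \<exists>a b. x \<in> stone_map a - stone_map b \<and> stone_map a - stone_map b \<subseteq> T"
  proof induction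
    case (Int S T)
    show ?case
    proof
      fix x assume "x \<in> S \<inter> T"
      then obtain a b c d where "x \<in> stone_map a - stone_map b" "stone_map a - stone_map b \<subseteq> S"
        "x \<in> stone_map c - stone_map d" "stone_map c - stone_map d \<subseteq> T"
        using Int.IH by blast
      moreover have "stone_map (inf a c) - stone_map (sup b d)
          = (stone_map a - stone_map b) \<inter> (stone_map c - stone_map d)"
        by (auto simp: stone_map_def priestley_space_inf_iff priestley_space_sup_iff)
      ultimately show "\<exists>a b. x \<in> stone_map a - stone_map b \<and> stone_map a - stone_map b \<subseteq> S \<inter> T"
        by (intro exI[of _ "inf a c"] exI[of _ "sup b d"]) auto
    qed
  next
    case (UN K)
    then show ?case by (meson Union_iff Union_upper order_trans)
  next
    case (Basis S)
    then obtain a b where "S = stone_map a \<inter> (priestley_space - stone_map b)"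
      by blast
    then have "S = stone_map a - stone_map b"
      using stone_map_subset_space by blast
    then show ?case by blast
  qed simp
  with assms(2) that show thesis by blast
qed

text \<open>
  The sets \<open>stone_map a\<close> and their complements form a subbase. A cover by the \<open>stone_map a\<close> with
  \<open>a \<in> A\<close> and the complements of the \<open>stone_map b\<close> with \<open>b \<in> B\<close> says that no prime filter contains
  \<open>B\<close> and avoids \<open>A\<close>; an inequality between a finite meet of \<open>B\<close> and a finite join of \<open>A\<close> is then
  a finite subcover.
\<close>
lemma compact_priestley_space: "compact_space (priestley_topology :: 'a::frame set topology)"
proof (rule Alexander_subbase_alt)
  let ?X = "priestley_space :: 'a set set"
  let ?P = "range stone_map :: 'a set set set" and ?N = "range (\<lambda>a :: 'a. ?X - stone_map a)"
  show "?X \<subseteq> \<Union>(?P \<union> ?N)"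
    by blast
  show "\<exists>C'. finite C' \<and> C' \<subseteq> C \<and> ?X \<subseteq> \<Union>C'" if C: "C \<subseteq> ?P \<union> ?N" "?X \<subseteq> \<Union>C" for C
  proof -
    define A where "A = {a. stone_map a \<in> C}"
    define B where "B = {b. ?X - stone_map b \<in> C}"
    have "A \<inter> x \<noteq> {}" if x: "x \<in> ?X" "B \<subseteq> x" for x
    proof -
      obtain W where W: "W \<in> C" "x \<in> W"
        using C(2) x by blast
      then consider a where "W = stone_map a" | b where "W = ?X - stone_map b"
        using C(1) by blast
      then show ?thesis
      proof cases
        case 1
        with W show ?thesis by (auto simp: A_def stone_map_def)
      next
        case 2
        with W have "b \<in> B" "b \<notin> x" by (auto simp: B_def stone_map_def)
        with x show ?thesis by blast
      qed
    qed
    then obtain T S where TS: "finite T" "T \<subseteq> B" "finite S" "S \<subseteq> A" "Inf T \<le> Sup S"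
      by (rule finite_meet_le_finite_join)
    let ?C = "stone_map ` S \<union> (\<lambda>b. ?X - stone_map b) ` T"
    have "x \<in> \<Union>?C" if x: "x \<in> ?X" for x
    proof (cases "T \<subseteq> x")
      case True
      then have "Sup S \<in> x"
        using TS x priestley_space_Inf_iff priestley_space_up by blast
      then show ?thesis
        using TS x by (auto simp: priestley_space_Sup_iff stone_map_def)
    next
      case False
      then show ?thesis
        using x by (auto simp: stone_map_def)
    qed
    then have "?X \<subseteq> \<Union>?C"
      by (rule subsetI)
    moreover have "finite ?C" "?C \<subseteq> C"
      using TS by (auto simp: A_def B_def)
    ultimately show ?thesis by (intro exI[of _ ?C] conjI)
  qed
  show "topology (arbitrary union_of (finite intersection_of (\<lambda>x. x \<in> ?P \<union> ?N) relative_to ?X))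
      = priestley_topology"
  proof (rule topology_base_unique)
    fix S assume "(finite intersection_of (\<lambda>x. x \<in> ?P \<union> ?N) relative_to ?X) S"
    then obtain \<U> where \<U>: "finite \<U>" "\<U> \<subseteq> ?P \<union> ?N" and S: "S = ?X \<inter> \<Inter>\<U>"
      by (auto simp: relative_to_def intersection_of_def)
    have "openin priestley_topology V" if "V \<in> \<U>" for V
      using \<U> that openin_stone_map openin_Diff_stone_map by blast
    then show "openin priestley_topology S"
      unfolding S using \<U>(1) openin_Int_Inter[of \<U> priestley_topology ?X]
      by (metis openin_topspace topspace_priestley_topology)
  next
    fix U and x :: "'a set" assume "openin priestley_topology U" "x \<in> U"
    then obtain a b where ab: "x \<in> stone_map a - stone_map b" "stone_map a - stone_map b \<subseteq> U"
      by (rule priestley_basis)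
    let ?\<U> = "{stone_map a, ?X - stone_map b}"
    have "(finite intersection_of (\<lambda>x. x \<in> ?P \<union> ?N) relative_to ?X) (?X \<inter> \<Inter>?\<U>)"
      unfolding relative_to_def intersection_of_def by (intro exI[of _ "\<Inter>?\<U>"] conjI exI[of _ ?\<U>]) auto
    moreover have "x \<in> ?X \<inter> \<Inter>?\<U>" "?X \<inter> \<Inter>?\<U> \<subseteq> U"
      using ab stone_map_subset_space by auto
    ultimately show "\<exists>B. (finite intersection_of (\<lambda>x. x \<in> ?P \<union> ?N) relative_to ?X) B \<and> x \<in> B \<and> B \<subseteq> U"
      by blast
  qed
qed

lemma compactin_finite_subfamily:
  assumes "compactin X K" "\<And>i. i \<in> I \<Longrightarrow> openin X (f i)" "K \<subseteq> \<Union>(f ` I)"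
  obtains J where "finite J" "J \<subseteq> I" "K \<subseteq> (\<Union>i\<in>J. f i)"
proof -
  have "\<forall>U\<in>f ` I. openin X U"
    using assms(2) by blast
  then obtain \<F> where "finite \<F>" "\<F> \<subseteq> f ` I" "K \<subseteq> \<Union>\<F>"
    using assms(1,3) unfolding compactin_def by meson
  then show thesis
    using that finite_subset_image[of \<F> f I] by blast
qed

text \<open>
  Since \<open>U\<close> is an upset, each \<open>x \<in> U\<close> contains, for every \<open>y\<close> outside \<open>U\<close>, an element missing from
  \<open>y\<close>. By compactness of the complement, finitely many of them suffice, and their meet \<open>a\<close>
  satisfies \<open>x \<in> stone_map a \<subseteq> U\<close>. By compactness of \<open>U\<close>, a finite join of such \<open>a\<close> gives \<open>U\<close>.
\<close>
lemma ClopUp_eq_range_stone_map: "ClopUp = range (stone_map :: 'a::frame \<Rightarrow> 'a set set)"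
proof (rule antisym)
  show "range (stone_map :: 'a \<Rightarrow> 'a set set) \<subseteq> ClopUp"
    using stone_map_ClopUp by blast
  show "ClopUp \<subseteq> range (stone_map :: 'a \<Rightarrow> 'a set set)"
  proof
    fix U :: "'a set set" assume U: "U \<in> ClopUp"
    let ?X = "priestley_space :: 'a set set"
    have closed: "closedin priestley_topology U" "closedin priestley_topology (?X - U)"
      using U by (auto simp: ClopUp_def simp flip: topspace_priestley_topology)
    then have compact: "compactin priestley_topology U" "compactin priestley_topology (?X - U)"
      using compact_priestley_space closedin_compact_space by blast+
    have sub: "U \<subseteq> ?X"
      using closed(1) closedin_subset topspace_priestley_topology by blast
    have nbhd: "\<exists>a\<in>x. stone_map a \<subseteq> U" if x: "x \<in> U" for x
    proof -
      let ?\<U> = "(\<lambda>a. ?X - stone_map a) ` x"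
      have "y \<in> \<Union>?\<U>" if y: "y \<in> ?X - U" for y
      proof -
        have "\<not> x \<subseteq> y"
          using U x y unfolding ClopUp_def by blast
        then show ?thesis
          using y by (auto simp: stone_map_def)
      qed
      then have "?X - U \<subseteq> \<Union>?\<U>"
        by (rule subsetI)
      then obtain T where T: "finite T" "T \<subseteq> x" "?X - U \<subseteq> (\<Union>a\<in>T. ?X - stone_map a)"
        by (rule compactin_finite_subfamily[OF compact(2) openin_Diff_stone_map])
      have "z \<in> U" if z: "z \<in> stone_map (Inf T)" for z
      proof -
        have "z \<in> ?X" "T \<subseteq> z"
          using z T(1) by (auto simp: stone_map_def priestley_space_Inf_iff)
        then show ?thesis
          using T(3) by (auto simp: stone_map_def)
      qed
      moreover have "Inf T \<in> x"
        using T x sub by (auto simp: priestley_space_Inf_iff)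
      ultimately show ?thesis by blast
    qed
    let ?\<V> = "stone_map ` {a. stone_map a \<subseteq> U}"
    have "U \<subseteq> \<Union>?\<V>"
      using nbhd sub by (fastforce simp: stone_map_def)
    then obtain S where S: "finite S" "S \<subseteq> {a. stone_map a \<subseteq> U}" "U \<subseteq> (\<Union>a\<in>S. stone_map a)"
      by (rule compactin_finite_subfamily[OF compact(1) openin_stone_map])
    have "stone_map (Sup S) = (\<Union>a\<in>S. stone_map a)"
      using S(1) by (auto simp: stone_map_def priestley_space_Sup_iff)
    with S have "U = stone_map (Sup S)"
      by auto
    then show "U \<in> range stone_map"
      by blast
  qed
qed

section \<open>The Hausdorff kernel\<close>

text \<open>
  The point \<open>y\<close> witnessing membership in the kernel contributes, through disjointness of the up-sets,
  some \<open>c \<in> y\<close>, and \<open>a \<notin> y\<close> gives \<open>\<not> c \<le> a\<close>. In the other direction, \<open>\<not> c \<le> a\<close> provides \<open>y\<close>.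
\<close>
lemma in_haus_stone_map_iff:
  fixes a :: "'a::frame"
  assumes "a \<noteq> top"
  shows "x \<in> haus (stone_map a) \<longleftrightarrow>
    x \<in> stone_map a \<and> (\<exists>c. \<not> c \<le> a \<and> pseudocomplement c \<in> x)"
proof
  assume "x \<in> haus (stone_map a)"
  then obtain y where x: "x \<in> stone_map a" and y: "y \<in> max_points (priestley_space - stone_map a)"
    and disj: "up_set y \<inter> up_set x = {}"
    using assms by (auto simp: haus_def stone_map_eq_space_iff)
  have y': "y \<in> priestley_space" "a \<notin> y"
    using y max_points_subset by (force simp: stone_map_def)+
  then obtain c where "c \<in> y" "pseudocomplement c \<in> x"
    using x disj disjoint_up_sets_iff_pseudocomplement[of x y] by (auto simp: stone_map_def)
  with x y' show "x \<in> stone_map a \<and> (\<exists>c. \<not> c \<le> a \<and> pseudocomplement c \<in> x)"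
    using priestley_space_up by blast
next
  assume "x \<in> stone_map a \<and> (\<exists>c. \<not> c \<le> a \<and> pseudocomplement c \<in> x)"
  then obtain c where x: "x \<in> stone_map a" and c: "\<not> c \<le> a" "pseudocomplement c \<in> x"
    by blast
  obtain y where y: "y \<in> max_points (priestley_space - stone_map a)" "c \<in> y"
    using c(1) by (rule maximal_point_separating)
  then have "up_set y \<inter> up_set x = {}"
    using x c(2) max_points_subset disjoint_up_sets_iff_pseudocomplement[of x y]
    by (fastforce simp: stone_map_def)
  with x y(1) show "x \<in> haus (stone_map a)"
    by (auto simp: haus_def)
qed

lemma haus_priestley_space: "haus priestley_space = priestley_space"
  by (auto simp: haus_def)

lemma haus_subset: "haus U \<subseteq> U"
  by (auto simp: haus_def)

text \<open>
  The supremum is the Heyting implication \<open>u \<rightarrow> v\<close>; the frame law makes it right adjoint to \<open>inf u\<close>.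
\<close>
lemma inf_le_iff_le_heyting:
  fixes u v z :: "'a::frame"
  shows "inf u z \<le> v \<longleftrightarrow> z \<le> Sup {w. inf u w \<le> v}"
proof
  assume "z \<le> Sup {w. inf u w \<le> v}"
  then have "inf u z \<le> inf u (Sup {w. inf u w \<le> v})"
    by (rule inf_mono[OF order_refl])
  also have "\<dots> \<le> v"
    unfolding inf_Sup_frame by (rule SUP_least) simp
  finally show "inf u z \<le> v" .
qed (auto intro: Sup_upper)

lemma hausdorff_frame_imp_haus_dense:
  assumes H: "hausdorff_frame TYPE('a::frame)"
  shows "priestley_topology closure_of haus (stone_map a) = stone_map (a :: 'a)"
proof (cases "a = top")
  case True
  then show ?thesis
    using closure_of_topspace[of "priestley_topology :: 'a set topology"]
    by (simp add: stone_map_top haus_priestley_space topspace_priestley_topology)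
next
  case False
  have "x \<in> priestley_topology closure_of haus (stone_map a)" if x: "x \<in> stone_map a" for x
    unfolding in_closure_of
  proof (intro conjI allI impI)
    show "x \<in> topspace priestley_topology"
      using x by (simp add: topspace_priestley_topology stone_map_def)
  next
    fix T assume "x \<in> T \<and> openin priestley_topology T"
    then obtain d e where de: "x \<in> stone_map d - stone_map e" "stone_map d - stone_map e \<subseteq> T"
      using priestley_basis by blast
    \<comment> \<open>This is the Heyting implication from \<open>inf a d\<close> to \<open>e\<close>. Keeping \<open>a\<close> in the antecedent forces the
      point found below back into \<open>stone_map a\<close>.\<close>
    let ?h = "Sup {w. inf (inf a d) w \<le> e}"
    have "inf a d \<in> x" "e \<notin> x" "x \<in> priestley_space"
      using x de(1) by (auto simp: stone_map_def priestley_space_inf_iff)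
    then have "\<not> inf (inf a d) a \<le> e"
      using priestley_space_up by (metis inf.absorb1 inf_le1)
    then have "\<not> a \<le> ?h"
      by (simp only: inf_le_iff_le_heyting[symmetric] not_False_eq_True)
    with H False obtain c where c: "\<not> c \<le> a" "\<not> pseudocomplement c \<le> ?h"
      unfolding hausdorff_frame_def by blast
    from c(2) have "\<not> inf (inf a d) (pseudocomplement c) \<le> e"
      by (simp only: inf_le_iff_le_heyting[symmetric] not_False_eq_True)
    then obtain z where z: "z \<in> max_points (priestley_space - stone_map e)"
        "inf (inf a d) (pseudocomplement c) \<in> z"
      by (rule maximal_point_separating)
    have "z \<in> priestley_space" "e \<notin> z"
      using z(1) max_points_subset by (force simp: stone_map_def)+
    moreover from this z(2) have "a \<in> z" "d \<in> z" "pseudocomplement c \<in> z"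
      by (simp_all add: priestley_space_inf_iff)
    ultimately have "z \<in> stone_map a" "z \<in> stone_map d - stone_map e" "pseudocomplement c \<in> z"
      by (simp_all add: stone_map_def)
    then show "\<exists>z. z \<in> haus (stone_map a) \<and> z \<in> T"
      using c(1) de(2) in_haus_stone_map_iff[OF False] by blast
  qed
  moreover have "priestley_topology closure_of haus (stone_map a) \<subseteq> stone_map a"
    by (rule closure_of_minimal[OF haus_subset closedin_stone_map])
  ultimately show ?thesis by blast
qed

lemma haus_dense_imp_hausdorff_frame:
  assumes D: "\<And>a :: 'a. priestley_topology closure_of haus (stone_map a) = stone_map a"
  shows "hausdorff_frame TYPE('a::frame)"
  unfolding hausdorff_frame_def
proof (intro allI impI)
  fix a b :: 'a assume ab: "a \<noteq> top \<and> \<not> a \<le> b"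
  then obtain x where "x \<in> stone_map a - stone_map b"
    using stone_map_subset_iff by blast
  with D[of a] have "\<exists>z. z \<in> haus (stone_map a) \<and> z \<in> stone_map a - stone_map b"
    using openin_stone_map_Diff[of a b] unfolding in_closure_of set_eq_iff by blast
  then obtain z where "z \<in> haus (stone_map a)" "z \<in> stone_map a" "z \<notin> stone_map b"
    by blast
  with ab obtain c where "\<not> c \<le> a" "pseudocomplement c \<in> z" "b \<notin> z" "z \<in> priestley_space"
    using in_haus_stone_map_iff[of a z] by (auto simp: stone_map_def)
  then show "\<exists>c. \<not> c \<le> a \<and> \<not> pseudocomplement c \<le> b"
    using priestley_space_up by blast
qed

theorem theorem5p10:
  shows "hausdorff_frame TYPE('a::frame) \<longleftrightarrow>
    (\<forall>U \<in> (ClopUp :: 'a set set set). priestley_topology closure_of (haus U) = U)"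
  unfolding ClopUp_eq_range_stone_map
  using hausdorff_frame_imp_haus_dense haus_dense_imp_hausdorff_frame by blast

end
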